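(* Let $(\mathcal{A},[-,-],[-,-,-])$ be an Akivis algebra and $\beta$ an endomorphism of $(\mathcal{A},[-,-],[-,-,-])$. Define on $\mathcal{A}$ a bilinear operation $[-,-]_\beta$ and a trilinear operation $[-,-,-]_\beta$ by $[x,y]_\beta:=[\beta(x),\beta(y)]$ $(=\beta([x,y]))$ and $[x,y,z]_\beta:=[\beta^2(x),\beta^2(y),\beta^2(z)]$ $(=\beta^2([x,y,z]))$ for all $x,y,z\in\mathcal{A}$, where $\beta^2=\beta\circ\beta$. Then $(\mathcal{A},[-,-]_\beta,[-,-,-]_\beta,\beta)$ is a multiplicative Hom-Akivis algebra. Moreover, suppose that $\tilde{\mathcal{A}}$ is another Akivis algebra and that $\tilde\beta$ is an endomorphism of $\tilde{\mathcal{A}}$, and define $[-,-]_{\tilde\beta}$ and $[-,-,-]_{\tilde\beta}$ on $\tilde{\mathcal{A}}$ from $\tilde\beta$ by the same formulas. If $f:\mathcal{A}\to\tilde{\mathcal{A}}$ is an Akivis algebra morphism satisfying $f\circ\beta=\tilde\beta\circ f$, then $f:(\mathcal{A},[-,-]_\beta,[-,-,-]_\beta,\beta)\to(\tilde{\mathcal{A}},[-,-]_{\tilde\beta},[-,-,-]_{\tilde\beta},\tilde\beta)$ is a morphism of multiplicative Hom-Akivis algebras.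
   Context: All vector spaces are over a field $\mathbb{K}$ of characteristic $0$; $\sigma$ denotes the sum over cyclic permutations of $x,y,z$. An Akivis algebra $(L,[-,-],[-,-,-])$ is a vector space $L$ with a bilinear skew-symmetric operation $[-,-]$ and a trilinear operation $[-,-,-]$ such that $\sigma[[x,y],z]=\sigma[x,y,z]-\sigma[y,x,z]$ for all $x,y,z\in L$. Morphisms (endomorphisms) of Akivis algebras are linear maps preserving both the binary and the ternary operation. A Hom-Akivis algebra is a quadruple $(V,[-,-],[-,-,-],\alpha)$ where $V$ is a vector space, $[-,-]:V\times V\to V$ is a skew-symmetric bilinear map, $[-,-,-]:V\times V\times V\to V$ is a trilinear map and $\alpha:V\to V$ is a linear map such that $\sigma[[x,y],\alpha(z)]=\sigma[x,y,z]-\sigma[y,x,z]$ for all $x,y,z\in V$. It is multiplicative if $\alpha([x,y])=[\alpha(x),\alpha(y)]$ and $\alpha([x,y,z])=[\alpha(x),\alpha(y),\alpha(z)]$ for all $x,y,z\in V$. A morphism of Hom-Akivis algebras is a linear map $\phi$ preserving both operations: $\phi([x,y])=[\phi(x),\phi(y)]$ and $\phi([x,y,z])=[\phi(x),\phi(y),\phi(z)]$, the brackets on the right-hand sides being those of the target. *)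

theory Defs
  imports Complex_Main
begin

text \<open>
  Vector spaces are instances of the library locale \<^locale>\<open>vector_space\<close>: the carrier is a whole
  type with its additive group, and the scalar multiplication is an explicit argument.
\<close>

text \<open>
  \<open>\<sigma> t(x,y,z)\<close>, the sum of an expression over the cyclic permutations of \<open>x, y, z\<close>. An expression
  such as \<open>\<sigma>[y,x,z]\<close> is \<open>cyclic_sum (\<lambda>x y z. [y,x,z]) x y z = [y,x,z] + [z,y,x] + [x,z,y]\<close>.
\<close>

definition cyclic_sum :: "('v \<Rightarrow> 'v \<Rightarrow> 'v \<Rightarrow> 'v) \<Rightarrow> 'v \<Rightarrow> 'v \<Rightarrow> 'v \<Rightarrow> 'v::ab_group_add" where
  "cyclic_sum t x y z = t x y z + t y z x + t z x y"

definition bilinear_op ::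
    "('k::field \<Rightarrow> 'v \<Rightarrow> 'v::ab_group_add) \<Rightarrow> ('v \<Rightarrow> 'v \<Rightarrow> 'v) \<Rightarrow> bool" where
  "bilinear_op s b \<longleftrightarrow>
    (\<forall>y. Vector_Spaces.linear s s (\<lambda>x. b x y)) \<and>
    (\<forall>x. Vector_Spaces.linear s s (\<lambda>y. b x y))"

definition trilinear_op ::
    "('k::field \<Rightarrow> 'v \<Rightarrow> 'v::ab_group_add) \<Rightarrow> ('v \<Rightarrow> 'v \<Rightarrow> 'v \<Rightarrow> 'v) \<Rightarrow> bool" where
  "trilinear_op s t \<longleftrightarrow>
    (\<forall>y z. Vector_Spaces.linear s s (\<lambda>x. t x y z)) \<and>
    (\<forall>x z. Vector_Spaces.linear s s (\<lambda>y. t x y z)) \<and>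
    (\<forall>x y. Vector_Spaces.linear s s (\<lambda>z. t x y z))"

definition skew_symmetric_op :: "('v \<Rightarrow> 'v \<Rightarrow> 'v::ab_group_add) \<Rightarrow> bool" where
  "skew_symmetric_op b \<longleftrightarrow> (\<forall>x y. b x y = - b y x)"

locale Akivis_algebra = vector_space scale
  for scale :: "'k::field_char_0 \<Rightarrow> 'v::ab_group_add \<Rightarrow> 'v" +
  fixes bin :: "'v \<Rightarrow> 'v \<Rightarrow> 'v"
    and tern :: "'v \<Rightarrow> 'v \<Rightarrow> 'v \<Rightarrow> 'v"
  assumes bin_bilinear: "bilinear_op scale bin"
    and bin_skew: "skew_symmetric_op bin"
    and tern_trilinear: "trilinear_op scale tern"
    and Akivis_identity:
      "cyclic_sum (\<lambda>x y z. bin (bin x y) z) x y z =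
       cyclic_sum (\<lambda>x y z. tern x y z) x y z - cyclic_sum (\<lambda>x y z. tern y x z) x y z"

locale Akivis_morphism =
  source: Akivis_algebra scale bin tern +
  target: Akivis_algebra scale' bin' tern' +
  Vector_Spaces.linear scale scale' f
  for scale :: "'k::field_char_0 \<Rightarrow> 'v::ab_group_add \<Rightarrow> 'v"
    and bin tern
    and scale' :: "'k \<Rightarrow> 'w::ab_group_add \<Rightarrow> 'w"
    and bin' tern' f +
  assumes map_bin: "f (bin x y) = bin' (f x) (f y)"
    and map_tern: "f (tern x y z) = tern' (f x) (f y) (f z)"

abbreviation Akivis_endomorphism ::
    "('k::field_char_0 \<Rightarrow> 'v \<Rightarrow> 'v::ab_group_add) \<Rightarrow> ('v \<Rightarrow> 'v \<Rightarrow> 'v) \<Rightarrow>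
     ('v \<Rightarrow> 'v \<Rightarrow> 'v \<Rightarrow> 'v) \<Rightarrow> ('v \<Rightarrow> 'v) \<Rightarrow> bool" where
  "Akivis_endomorphism scale bin tern \<equiv> Akivis_morphism scale bin tern scale bin tern"

locale Hom_Akivis_algebra = vector_space scale
  for scale :: "'k::field_char_0 \<Rightarrow> 'v::ab_group_add \<Rightarrow> 'v" +
  fixes bin :: "'v \<Rightarrow> 'v \<Rightarrow> 'v"
    and tern :: "'v \<Rightarrow> 'v \<Rightarrow> 'v \<Rightarrow> 'v"
    and \<alpha> :: "'v \<Rightarrow> 'v"
  assumes bin_bilinear: "bilinear_op scale bin"
    and bin_skew: "skew_symmetric_op bin"
    and tern_trilinear: "trilinear_op scale tern"
    and twist_linear: "Vector_Spaces.linear scale scale \<alpha>"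
    and Hom_Akivis_identity:
      "cyclic_sum (\<lambda>x y z. bin (bin x y) (\<alpha> z)) x y z =
       cyclic_sum (\<lambda>x y z. tern x y z) x y z - cyclic_sum (\<lambda>x y z. tern y x z) x y z"

locale multiplicative_Hom_Akivis_algebra = Hom_Akivis_algebra +
  assumes twist_bin: "\<alpha> (bin x y) = bin (\<alpha> x) (\<alpha> y)"
    and twist_tern: "\<alpha> (tern x y z) = tern (\<alpha> x) (\<alpha> y) (\<alpha> z)"

text \<open>
  A morphism of (multiplicative) Hom-Akivis algebras is a linear map preserving both operations;
  compatibility with the twisting maps \<open>\<alpha>\<close>, \<open>\<alpha>'\<close> is not part of the notion. The twisting maps
  enter only through source and target being multiplicative Hom-Akivis algebras.
\<close>

locale multiplicative_Hom_Akivis_morphism =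
  source: multiplicative_Hom_Akivis_algebra scale bin tern \<alpha> +
  target: multiplicative_Hom_Akivis_algebra scale' bin' tern' \<alpha>' +
  Vector_Spaces.linear scale scale' f
  for scale :: "'k::field_char_0 \<Rightarrow> 'v::ab_group_add \<Rightarrow> 'v"
    and bin tern \<alpha>
    and scale' :: "'k \<Rightarrow> 'w::ab_group_add \<Rightarrow> 'w"
    and bin' tern' \<alpha>' f +
  assumes map_bin: "f (bin x y) = bin' (f x) (f y)"
    and map_tern: "f (tern x y z) = tern' (f x) (f y) (f z)"

definition twisted_bin :: "('v \<Rightarrow> 'v) \<Rightarrow> ('v \<Rightarrow> 'v \<Rightarrow> 'v) \<Rightarrow> 'v \<Rightarrow> 'v \<Rightarrow> 'v" where
  "twisted_bin \<beta> bin x y = bin (\<beta> x) (\<beta> y)"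

definition twisted_tern ::
    "('v \<Rightarrow> 'v) \<Rightarrow> ('v \<Rightarrow> 'v \<Rightarrow> 'v \<Rightarrow> 'v) \<Rightarrow> 'v \<Rightarrow> 'v \<Rightarrow> 'v \<Rightarrow> 'v" where
  "twisted_tern \<beta> tern x y z = tern ((\<beta> \<circ> \<beta>) x) ((\<beta> \<circ> \<beta>) y) ((\<beta> \<circ> \<beta>) z)"

end

theory Submission
  imports Defs
begin

text \<open>With one argument fixed, the twisted operation is a partial map of \<open>b\<close>
  composed with the linear map \<open>g\<close>. The fixed argument enters as \<open>g y\<close> or
  \<open>g x\<close>, which is harmless because linearity of the partial maps of \<open>b\<close> is
  available at every fixed value.\<close>

lemma bilinear_op_twisted_bin:
  assumes "bilinear_op s b" and "Vector_Spaces.linear s s g"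
  shows "bilinear_op s (twisted_bin g b)"
proof -
  have "Vector_Spaces.linear s s (\<lambda>x. b (g x) (g y))" for y
    using assms Vector_Spaces.linear_compose[of s s g s "\<lambda>x. b x (g y)"]
    by (simp add: bilinear_op_def comp_def)
  moreover have "Vector_Spaces.linear s s (\<lambda>y. b (g x) (g y))" for x
    using assms Vector_Spaces.linear_compose[of s s g s "b (g x)"]
    by (simp add: bilinear_op_def comp_def)
  ultimately show ?thesis
    by (simp add: bilinear_op_def twisted_bin_def)
qed

text \<open>The same composition argument in each of the three slots, now with the linear map
  \<open>g \<circ> g\<close>.\<close>

lemma trilinear_op_twisted_tern:
  assumes "trilinear_op s t" and "Vector_Spaces.linear s s g"
  shows "trilinear_op s (twisted_tern g t)"
proof -
  let ?h = "g \<circ> g"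
  have h: "Vector_Spaces.linear s s ?h"
    using assms(2) by (rule Vector_Spaces.linear_compose) (rule assms(2))
  have "Vector_Spaces.linear s s (\<lambda>x. t (?h x) (?h y) (?h z))" for y z
    using assms(1) h Vector_Spaces.linear_compose[of s s ?h s "\<lambda>x. t x (?h y) (?h z)"]
    by (simp add: trilinear_op_def comp_def)
  moreover have "Vector_Spaces.linear s s (\<lambda>y. t (?h x) (?h y) (?h z))" for x z
    using assms(1) h Vector_Spaces.linear_compose[of s s ?h s "\<lambda>y. t (?h x) y (?h z)"]
    by (simp add: trilinear_op_def comp_def)
  moreover have "Vector_Spaces.linear s s (\<lambda>z. t (?h x) (?h y) (?h z))" for x y
    using assms(1) h Vector_Spaces.linear_compose[of s s ?h s "t (?h x) (?h y)"]
    by (simp add: trilinear_op_def comp_def)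
  ultimately show ?thesis
    by (simp add: trilinear_op_def twisted_tern_def)
qed

text \<open>
  Both sides of the Hom-Akivis identity for the twisted operations at \<open>x, y, z\<close> are the
  corresponding sides of the Akivis identity at \<open>\<beta>\<^sup>2 x, \<beta>\<^sup>2 y, \<beta>\<^sup>2 z\<close>.
\<close>

lemma multiplicative_Hom_Akivis_algebra_twisted:
  assumes "Akivis_endomorphism scale bin tern \<beta>"
  shows "multiplicative_Hom_Akivis_algebra scale (twisted_bin \<beta> bin) (twisted_tern \<beta> tern) \<beta>"
proof -
  interpret E: Akivis_morphism scale bin tern scale bin tern \<beta>
    by (rule assms)
  have linear: "Vector_Spaces.linear scale scale \<beta>"
    by unfold_locales
  show ?thesis
  proof
    show "bilinear_op scale (twisted_bin \<beta> bin)"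
      using E.source.bin_bilinear linear by (rule bilinear_op_twisted_bin)
    show "trilinear_op scale (twisted_tern \<beta> tern)"
      using E.source.tern_trilinear linear by (rule trilinear_op_twisted_tern)
    show "skew_symmetric_op (twisted_bin \<beta> bin)"
      using E.source.bin_skew unfolding skew_symmetric_op_def twisted_bin_def by blast
    show "cyclic_sum (\<lambda>x y z. twisted_bin \<beta> bin (twisted_bin \<beta> bin x y) (\<beta> z)) x y z =
        cyclic_sum (\<lambda>x y z. twisted_tern \<beta> tern x y z) x y z -
        cyclic_sum (\<lambda>x y z. twisted_tern \<beta> tern y x z) x y z" for x y z
      \<comment> \<open>On the left, the outer twisted bracket applies \<beta> to the inner one;
        since \<beta> preserves \<open>bin\<close>, every variable then carries two copies of
        \<beta>. This is why the ternary operation is twisted by the square of \<beta>.\<close>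
      using E.source.Akivis_identity[of "\<beta> (\<beta> x)" "\<beta> (\<beta> y)" "\<beta> (\<beta> z)"]
      by (simp add: cyclic_sum_def twisted_bin_def twisted_tern_def E.map_bin)
    \<comment> \<open>Multiplicativity reduces to \<beta> preserving the original operations, since
      the twisting map and the twists inside the operations are powers of the same \<beta>.\<close>
    show "\<beta> (twisted_bin \<beta> bin x y) = twisted_bin \<beta> bin (\<beta> x) (\<beta> y)" for x y
      by (simp add: twisted_bin_def E.map_bin)
    show "\<beta> (twisted_tern \<beta> tern x y z) = twisted_tern \<beta> tern (\<beta> x) (\<beta> y) (\<beta> z)" for x y z
      by (simp add: twisted_tern_def E.map_tern)
  qed
qed

text \<open>First \<open>f\<close> passes through the original operation, being an Akivis morphism;
  then in each argument it passes through the twist, turning \<beta> into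
  \<open>\<beta>'\<close>.\<close>

lemma multiplicative_Hom_Akivis_morphism_twisted:
  assumes "Akivis_endomorphism scale bin tern \<beta>"
    and "Akivis_endomorphism scale' bin' tern' \<beta>'"
    and "Akivis_morphism scale bin tern scale' bin' tern' f"
    and "f \<circ> \<beta> = \<beta>' \<circ> f"
  shows "multiplicative_Hom_Akivis_morphism
    scale (twisted_bin \<beta> bin) (twisted_tern \<beta> tern) \<beta>
    scale' (twisted_bin \<beta>' bin') (twisted_tern \<beta>' tern') \<beta>' f"
proof -
  interpret F: Akivis_morphism scale bin tern scale' bin' tern' f
    by (rule assms(3))
  \<comment> \<open>In this pointwise form the relation is used once per argument for the binary
    operation and twice for the ternary one.\<close>
  have commute: "f (\<beta> x) = \<beta>' (f x)" for x
    using assms(4) by (rule comp_eq_dest)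
  show ?thesis
  proof (intro multiplicative_Hom_Akivis_morphism.intro
      multiplicative_Hom_Akivis_morphism_axioms.intro)
    show "multiplicative_Hom_Akivis_algebra scale (twisted_bin \<beta> bin) (twisted_tern \<beta> tern) \<beta>"
      using assms(1) by (rule multiplicative_Hom_Akivis_algebra_twisted)
    show "multiplicative_Hom_Akivis_algebra
        scale' (twisted_bin \<beta>' bin') (twisted_tern \<beta>' tern') \<beta>'"
      using assms(2) by (rule multiplicative_Hom_Akivis_algebra_twisted)
    show "Vector_Spaces.linear scale scale' f"
      by unfold_locales
    show "f (twisted_bin \<beta> bin x y) = twisted_bin \<beta>' bin' (f x) (f y)" for x y
      by (simp add: twisted_bin_def F.map_bin commute)
    show "f (twisted_tern \<beta> tern x y z) = twisted_tern \<beta>' tern' (f x) (f y) (f z)" for x y z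
      by (simp add: twisted_tern_def F.map_tern commute)
  qed
qed

theorem corollary4p6:
  fixes scale :: "'k::field_char_0 \<Rightarrow> 'a::ab_group_add \<Rightarrow> 'a"
    and bin :: "'a \<Rightarrow> 'a \<Rightarrow> 'a"
    and tern :: "'a \<Rightarrow> 'a \<Rightarrow> 'a \<Rightarrow> 'a"
    and \<beta> :: "'a \<Rightarrow> 'a"
  assumes "Akivis_algebra scale bin tern"
    and "Akivis_endomorphism scale bin tern \<beta>"
  shows "(\<forall>x y. twisted_bin \<beta> bin x y = \<beta> (bin x y)) \<and>
    (\<forall>x y z. twisted_tern \<beta> tern x y z = (\<beta> \<circ> \<beta>) (tern x y z)) \<and>
    multiplicative_Hom_Akivis_algebra scale (twisted_bin \<beta> bin) (twisted_tern \<beta> tern) \<beta> \<and>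
    (\<forall>(scale' :: 'k \<Rightarrow> 'b::ab_group_add \<Rightarrow> 'b) bin' tern' \<beta>' f.
      Akivis_algebra scale' bin' tern' \<longrightarrow>
      Akivis_endomorphism scale' bin' tern' \<beta>' \<longrightarrow>
      Akivis_morphism scale bin tern scale' bin' tern' f \<longrightarrow>
      f \<circ> \<beta> = \<beta>' \<circ> f \<longrightarrow>
      multiplicative_Hom_Akivis_morphism
        scale (twisted_bin \<beta> bin) (twisted_tern \<beta> tern) \<beta>
        scale' (twisted_bin \<beta>' bin') (twisted_tern \<beta>' tern') \<beta>' f)"
proof (intro conjI allI impI)
  interpret E: Akivis_morphism scale bin tern scale bin tern \<beta>
    by (rule assms(2))
  show "twisted_bin \<beta> bin x y = \<beta> (bin x y)" for x y
    by (simp add: twisted_bin_def E.map_bin)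
  show "twisted_tern \<beta> tern x y z = (\<beta> \<circ> \<beta>) (tern x y z)" for x y z
    by (simp add: twisted_tern_def E.map_tern)
\<comment> \<open>Two goals are left, the Hom-Akivis structure and the claim about \<open>f\<close>;
  each is an instance of one of the two preceding lemmas.\<close>
qed (use assms(2) in \<open>blast intro: multiplicative_Hom_Akivis_algebra_twisted
    multiplicative_Hom_Akivis_morphism_twisted\<close>)+

end
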